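(* There exists a constant $\alpha<1$ such that for all sufficiently large $k\in\mathbb{N}$ and any partition $\lambda$ of $k$ with $\ell(\lambda)\geq2$, if $\lambda_1>\alpha k$ then $\pi(\Delta_\lambda)>k!/k^k$.
   Context: A $k$-graph is a finite $k$-uniform hypergraph. For a $k$-graph $F$, $\mathrm{ex}(n,F)$ is the maximum number of edges of a $k$-graph on $n$ vertices that contains no (not necessarily induced) subgraph isomorphic to $F$, and the Turán density is $\pi(F)=\lim_{n\to\infty}\mathrm{ex}(n,F)/\binom nk$. A partition $\lambda=(\lambda_1,\ldots,\lambda_\ell)$ of $k$ is a sequence of positive integers $\lambda_1\geq\cdots\geq\lambda_\ell$ with $|\lambda|=\sum_i\lambda_i=k$; its length is $\ell(\lambda)=\ell$. For a partition $\lambda$ of $k$ with $\ell=\ell(\lambda)\geq2$, the $\lambda$-tent $\Delta_\lambda$ is the $k$-graph (unique up to isomorphism) whose edges are $e,e_1,\ldots,e_\ell$ (each of size $k$) and whose vertices are exactly those lying in these edges, with a distinguished vertex $v\notin e$, such that: $v\in e_i$ and $|e_i\cap e|=\lambda_i$ for every $i\in\{1,\ldots,\ell\}$, and $e_i\cap e_j=\{v\}$ for all $i\neq j$. The edge $e$ is called the base and $v$ the apex. *)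

theory Defs
  imports Complex_Main
begin

text \<open>A hypergraph is a pair of a vertex set and an edge set.\<close>

type_synonym 'a hypergraph = "'a set \<times> 'a set set"

abbreviation verts :: "'a hypergraph \<Rightarrow> 'a set" where
  "verts H \<equiv> fst H"

abbreviation edges :: "'a hypergraph \<Rightarrow> 'a set set" where
  "edges H \<equiv> snd H"

definition kgraph :: "nat \<Rightarrow> 'a hypergraph \<Rightarrow> bool" where
  "kgraph k H \<longleftrightarrow> finite (verts H) \<and> (\<forall>e\<in>edges H. e \<subseteq> verts H \<and> card e = k)"

text \<open>\<open>H\<close> has a (not necessarily induced) subgraph isomorphic to \<open>F\<close>.\<close>

definition contains_copy :: "'a hypergraph \<Rightarrow> 'b hypergraph \<Rightarrow> bool" where
  "contains_copy H F \<longleftrightarrow>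
     (\<exists>f. inj_on f (verts F) \<and> f ` verts F \<subseteq> verts H \<and> (\<forall>e\<in>edges F. f ` e \<in> edges H))"

text \<open>
  Every finite hypergraph has an isomorphic copy on natural numbers, so it is enough to let the
  host hypergraphs range over those. If \<open>F\<close> has an edge, the edgeless hypergraph is a
  competitor, so the maximum is over a nonempty set of numbers that are at most \<open>n choose k\<close>.
\<close>

definition turan_number :: "nat \<Rightarrow> nat \<Rightarrow> 'a hypergraph \<Rightarrow> nat" where
  "turan_number k n F =
     Max {card (edges H) | H :: nat hypergraph.
            kgraph k H \<and> card (verts H) = n \<and> \<not> contains_copy H F}"

definition turan_density :: "nat \<Rightarrow> 'a hypergraph \<Rightarrow> real" where
  "turan_density k F = lim (\<lambda>n. real (turan_number k n F) / real (n choose k))"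

text \<open>
  The parts are listed as \<open>lam ! 0, lam ! 1, \<dots>\<close>, i.e. with indices shifted by one.
\<close>

definition is_partition :: "nat \<Rightarrow> nat list \<Rightarrow> bool" where
  "is_partition k lam \<longleftrightarrow> (\<forall>x\<in>set lam. 0 < x) \<and> sorted_wrt (\<ge>) lam \<and> sum_list lam = k"

text \<open>
  A tent is determined by its partition only up to isomorphism, so being a tent is a predicate.
\<close>

definition is_tent :: "nat list \<Rightarrow> 'a hypergraph \<Rightarrow> bool" where
  "is_tent lam F \<longleftrightarrow> kgraph (sum_list lam) F \<and>
     (\<exists>e v es.
        edges F = insert e (es ` {..<length lam}) \<and>
        verts F = \<Union> (edges F) \<and>
        v \<notin> e \<and>
        (\<forall>i<length lam. v \<in> es i \<and> card (es i \<inter> e) = lam ! i) \<and>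
        (\<forall>i<length lam. \<forall>j<length lam. i \<noteq> j \<longrightarrow> es i \<inter> es j = {v}))"

lemma card_insert_Un_disjoint:
  assumes "finite A" "finite B" "v \<notin> A" "v \<notin> B" "A \<inter> B = {}"
  shows "card (insert v (A \<union> B)) = Suc (card A + card B)"
  using assms by (simp add: card_Un_disjoint)

lemma part_add_le_sum_list:
  fixes lam :: "nat list"
  assumes "i < length lam" "j < length lam" "i \<noteq> j"
  shows "lam ! i + lam ! j \<le> sum_list lam"
proof -
  have "(\<Sum>m\<in>{i, j}. lam ! m) \<le> (\<Sum>m\<in>{0..<length lam}. lam ! m)"
    by (rule sum_mono2) (use assms in auto)
  then show ?thesis using assms by (simp add: sum_list_sum_nth)
qed

text \<open>Tents exist, so statements about all tents of a given partition are not vacuous.\<close>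

lemma is_tent_exists:
  assumes lam: "is_partition k lam" and len: "length lam \<ge> 2"
  shows "\<exists>F :: nat hypergraph. is_tent lam F"
proof -
  have sl: "sum_list lam = k" and pos: "\<And>i. i < length lam \<Longrightarrow> 0 < lam ! i"
    using lam by (auto simp: is_partition_def)
  define s where "s i = sum_list (take i lam)" for i
  have s_Suc: "s (Suc i) = s i + lam ! i" if "i < length lam" for i
    using that by (simp add: s_def take_Suc_conv_app_nth)
  have s_mono: "s i \<le> s j" if "i \<le> j" for i j
  proof -
    have "take j lam = take i lam @ take (j - i) (drop i lam)"
      using that by (metis le_add_diff_inverse take_add)
    then show ?thesis by (simp add: s_def)
  qed
  have s_le: "s (Suc i) \<le> k" if "i < length lam" for i
    using s_mono[of "Suc i" "length lam"] that sl by (simp add: s_def)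
  have part_lt: "lam ! i < k" if i: "i < length lam" for i
  proof -
    define j :: nat where "j = (if i = 0 then 1 else 0)"
    have j: "j < length lam" "j \<noteq> i"
      using len by (auto simp: j_def)
    then show ?thesis using part_add_le_sum_list[of i lam j] pos[of j] i sl by simp
  qed
  define B where "B i = {s i..<s (Suc i)}" for i
  define P where "P i = {k + 1 + i * k..<k + 1 + i * k + (k - 1 - lam ! i)}" for i
  define es where "es i = insert k (B i \<union> P i)" for i
  define E where "E = insert {..<k} (es ` {..<length lam})"
  have B_sub: "B i \<subseteq> {..<k}" if "i < length lam" for i
    using s_le[OF that] by (auto simp: B_def)
  have P_gt: "P i \<subseteq> {k<..}" for i by (auto simp: P_def)
  have BP: "B i \<inter> P j = {}" if "i < length lam" for i j
    using B_sub[OF that] P_gt[of j] by (force dest: subsetD)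
  have es_card: "card (es i) = k" if i: "i < length lam" for i
  proof -
    have "card (es i) = Suc (card (B i) + card (P i))"
      unfolding es_def
    proof (rule card_insert_Un_disjoint)
      show "B i \<inter> P i = {}" "k \<notin> B i" "k \<notin> P i"
        using BP[OF i] B_sub[OF i] P_gt[of i] by auto
    qed (simp_all add: B_def P_def)
    then show ?thesis using part_lt[OF i] s_Suc[OF i] by (simp add: B_def P_def)
  qed
  have es_base: "es i \<inter> {..<k} = B i" if i: "i < length lam" for i
    using B_sub[OF i] P_gt[of i] by (auto simp: es_def subset_iff dest: less_asym)
  have disj: "es i \<inter> es j = {k}" if ij: "i < j" and j: "j < length lam" for i j
  proof -
    have "B i \<inter> B j = {}" using s_mono[of "Suc i" j] ij by (auto simp: B_def)
    moreover have "P i \<inter> P j = {}"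
    proof -
      have "i * k + k \<le> j * k"
        using mult_le_mono1[of "Suc i" j k] ij by simp
      then show ?thesis by (auto simp: P_def)
    qed
    moreover have "B i \<inter> P j = {}" "B j \<inter> P i = {}"
      using BP ij j by auto
    ultimately show ?thesis unfolding es_def by blast
  qed
  have disj': "es i \<inter> es j = {k}" if "i < length lam" "j < length lam" "i \<noteq> j" for i j
    using disj[of i j] disj[of j i] that by (cases "i < j") (auto simp: Int_commute)
  have fin: "finite (\<Union> E)" by (auto simp: E_def es_def B_def P_def)
  have "kgraph (sum_list lam) (\<Union> E, E)"
    using fin es_card sl by (auto simp: kgraph_def E_def)
  moreover have "\<forall>i<length lam. k \<in> es i \<and> card (es i \<inter> {..<k}) = lam ! i"
    using es_base s_Suc by (auto simp: B_def es_def)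
  ultimately have "is_tent lam (\<Union> E, E)"
    unfolding is_tent_def using disj'
    by (intro conjI exI[of _ "{..<k}"] exI[of _ k] exI[of _ es]) (auto simp: E_def)
  then show ?thesis by blast
qed

end

theory Submission
  imports Defs "HOL-Library.FuncSet"
begin

text \<open>
  The number \<open>k! / k^k\<close> is the limiting density of the complete balanced \<open>k\<close>-partite
  \<open>k\<close>-graph, that is, of the blow-ups of a single edge. The idea is to blow up many edges at
  once. Let \<open>S\<close> be a family of \<open>k\<close>-subsets of an \<open>m\<close>-set, any two of which meet in at most
  \<open>\<alpha> k\<close> points. Its blow-ups contain no \<open>\<lambda>\<close>-tent with \<open>\<lambda>\<^sub>1 > \<alpha> k\<close>: the base \<open>e\<close> and the edge
  \<open>e\<^sub>1\<close> share more than \<open>\<alpha> k\<close> vertices and hence lie over the same member of \<open>S\<close>, so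
  the apex \<open>v \<in> e\<^sub>1\<close> lies in the same part as some vertex \<open>u\<close> of \<open>e\<close>. But the tent has an edge
  \<open>e\<^sub>i\<close> that contains both \<open>u\<close> and \<open>v\<close>, whereas an edge of a blow-up meets each part at
  most once (\<open>blow_up_tent_free\<close>).

  The blow-ups of \<open>S\<close> have limiting density at least \<open>card S * k! / m^k\<close>
  (\<open>blow_up_density\<close>), which exceeds \<open>k! / k^k\<close> as soon as \<open>card S > (m / k)^k\<close>. For
  \<open>m = 2 k\<close> this asks for more than \<open>2^k\<close> sets. There are about \<open>4^k\<close> sets of size \<open>k\<close> to
  choose from, and when \<open>\<alpha>\<close> is close to \<open>1\<close> a chosen set excludes only \<open>c^k\<close> others with
  \<open>c\<close> close to \<open>1\<close>, so that the greedy choice of Gilbert and Varshamov gives a large enough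
  family (\<open>large_packing\<close>); \<open>\<alpha> = 15/16\<close> suffices.

  The Turan density is defined as a limit; that it exists, and may be bounded from below along a
  subsequence of host sizes, is the averaging argument of Katona, Nemetz and Simonovits
  (\<open>turan_ratio_decreasing\<close>).
\<close>

section \<open>Turan numbers and the Turan density\<close>

lemma finite_edges: "kgraph k H \<Longrightarrow> finite (edges H)"
  by (rule finite_subset[of _ "Pow (verts H)"]) (auto simp: kgraph_def)

lemma card_edges_le_binomial:
  assumes "kgraph k H"
  shows "card (edges H) \<le> card (verts H) choose k"
proof -
  have "edges H \<subseteq> {B. B \<subseteq> verts H \<and> card B = k}" "finite (verts H)"
    using assms by (auto simp: kgraph_def)
  then have "card (edges H) \<le> card {B. B \<subseteq> verts H \<and> card B = k}"
    by (intro card_mono) auto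
  then show ?thesis using n_subsets[OF \<open>finite (verts H)\<close>] by simp
qed

lemma finite_competitor_sizes:
  "finite {card (edges H) | H :: nat hypergraph.
     kgraph k H \<and> card (verts H) = n \<and> \<not> contains_copy H F}"
  by (rule finite_subset[of _ "{..n choose k}"]) (auto dest: card_edges_le_binomial)

lemma turan_number_ge:
  fixes H :: "nat hypergraph"
  assumes "kgraph k H" "card (verts H) = n" "\<not> contains_copy H F"
  shows "card (edges H) \<le> turan_number k n F"
  unfolding turan_number_def by (rule Max_ge[OF finite_competitor_sizes]) (use assms in blast)

lemma turan_number_attained:
  assumes "edges F \<noteq> {}"
  obtains H :: "nat hypergraph"
  where "kgraph k H" "card (verts H) = n" "\<not> contains_copy H F"
    "turan_number k n F = card (edges H)"
proof -
  let ?A = "{card (edges H) | H :: nat hypergraph.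
     kgraph k H \<and> card (verts H) = n \<and> \<not> contains_copy H F}"
  have "kgraph k ({..<n}, {})" "card (verts ({..<n}, {})) = n"
    "\<not> contains_copy ({..<n}, {}) F"
    using assms by (auto simp: kgraph_def contains_copy_def)
  then have "?A \<noteq> {}" by blast
  then have "turan_number k n F \<in> ?A"
    unfolding turan_number_def by (rule Max_in[OF finite_competitor_sizes])
  then show ?thesis using that by blast
qed

text \<open>
  Delete each vertex of an extremal hypergraph in turn: an edge survives the deletion of every
  vertex outside it, and no deletion creates a copy of \<open>F\<close>.
\<close>

lemma turan_number_averaging:
  assumes "edges F \<noteq> {}"
  shows "(Suc n - k) * turan_number k (Suc n) F \<le> Suc n * turan_number k n F"
proof -
  obtain H :: "nat hypergraph" where H: "kgraph k H" "card (verts H) = Suc n"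
      "\<not> contains_copy H F" and max: "turan_number k (Suc n) F = card (edges H)"
    using turan_number_attained[OF assms] by metis
  have fin: "finite (verts H)" "finite (edges H)"
    using H(1) finite_edges[OF H(1)] by (auto simp: kgraph_def)
  have "(Suc n - k) * card (edges H) = (\<Sum>v\<in>verts H. card {e \<in> edges H. v \<notin> e})"
  proof (rule sum_multicount[OF fin, symmetric], intro ballI)
    fix e assume "e \<in> edges H"
    then have "e \<subseteq> verts H" "card e = k" using H(1) by (auto simp: kgraph_def)
    moreover have "{v \<in> verts H. v \<notin> e} = verts H - e" by auto
    ultimately show "card {v \<in> verts H. v \<notin> e} = Suc n - k"
      using H(2) fin by (simp add: card_Diff_subset finite_subset)
  qed
  also have "\<dots> \<le> (\<Sum>v\<in>verts H. turan_number k n F)"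
  proof (rule sum_mono)
    fix v assume v: "v \<in> verts H"
    let ?H = "(verts H - {v}, {e \<in> edges H. v \<notin> e})"
    have "kgraph k ?H" using H(1) by (auto simp: kgraph_def)
    moreover have "card (verts ?H) = n" using v H(2) fin by simp
    moreover have "\<not> contains_copy ?H F"
      using H(3) unfolding contains_copy_def by fastforce
    ultimately show "card {e \<in> edges H. v \<notin> e} \<le> turan_number k n F"
      using turan_number_ge by fastforce
  qed
  finally show ?thesis using H(2) max by simp
qed

lemma turan_ratio_decreasing:
  assumes "edges F \<noteq> {}" and "k \<le> n"
  shows "real (turan_number k (Suc n) F) / real (Suc n choose k)
    \<le> real (turan_number k n F) / real (n choose k)"
proof -
  let ?a = "turan_number k (Suc n) F" and ?b = "turan_number k n F"
  have absorb: "(Suc n - k) * (Suc n choose k) = Suc n * (n choose k)"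
    using binomial_absorb_comp[of "Suc n" k] by simp
  have "Suc n * (?a * (n choose k)) = ((Suc n - k) * ?a) * (Suc n choose k)"
    by (metis absorb mult.assoc mult.commute)
  also have "\<dots> \<le> Suc n * ?b * (Suc n choose k)"
    using turan_number_averaging[OF assms(1)] by (rule mult_le_mono1)
  finally have "?a * (n choose k) \<le> ?b * (Suc n choose k)"
    by (metis Suc_mult_le_cancel1 mult.assoc)
  then have "real ?a * real (n choose k) \<le> real ?b * real (Suc n choose k)"
    by (metis of_nat_le_iff of_nat_mult)
  moreover have "0 < n choose k" "0 < Suc n choose k" using assms(2)
    by (auto intro: zero_less_binomial)
  ultimately show ?thesis by (simp add: divide_simps del: binomial_Suc_Suc)
qed

lemma turan_density_ge:
  assumes F: "edges F \<noteq> {}"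
    and inf: "\<And>n. \<exists>N\<ge>n. c \<le> real (turan_number k N F) / real (N choose k)"
  shows "c \<le> turan_density k F"
proof -
  define a where "a n = real (turan_number k n F) / real (n choose k)" for n
  have dec: "decseq (\<lambda>n. a (n + k))"
    unfolding a_def by (rule decseq_SucI) (use turan_ratio_decreasing[OF F] in simp)
  have ge: "c \<le> a (n + k)" for n
  proof -
    obtain N where N: "N \<ge> n + k" "c \<le> a N" using inf unfolding a_def by blast
    have "a ((N - k) + k) \<le> a (n + k)" by (rule decseqD[OF dec]) (use N in simp)
    then show ?thesis using N by simp
  qed
  obtain L where L: "(\<lambda>n. a (n + k)) \<longlonglongrightarrow> L"
    using decseq_convergent[OF dec] ge by blast
  then have "a \<longlonglongrightarrow> L" by (rule LIMSEQ_offset)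
  then have "turan_density k F = L"
    unfolding turan_density_def a_def[symmetric] by (rule limI)
  moreover have "c \<le> L" using LIMSEQ_le_const[OF L] ge by blast
  ultimately show ?thesis by simp
qed

section \<open>Blow-ups\<close>

text \<open>
  Vertex \<open>i < m\<close> is replaced by the \<open>s\<close> vertices below \<open>m * s\<close> that are congruent to \<open>i\<close>
  modulo \<open>m\<close>.
\<close>

definition blow_up :: "nat \<Rightarrow> nat \<Rightarrow> nat set set \<Rightarrow> nat hypergraph" where
  "blow_up m s S =
     ({..<m * s}, {e. e \<subseteq> {..<m * s} \<and> inj_on (\<lambda>x. x mod m) e \<and> (\<lambda>x. x mod m) ` e \<in> S})"

lemma kgraph_blow_up:
  assumes "\<And>T. T \<in> S \<Longrightarrow> card T = k"
  shows "kgraph k (blow_up m s S)"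
  unfolding kgraph_def blow_up_def using assms by (auto simp: card_image[symmetric])

lemma card_edges_blow_up:
  assumes S: "\<And>T. T \<in> S \<Longrightarrow> T \<subseteq> {..<m} \<and> card T = k"
  shows "card S * s ^ k \<le> card (edges (blow_up m s S))"
proof -
  have finS: "finite S"
    by (rule finite_subset[of _ "Pow {..<m}"]) (use S in auto)
  have finT: "finite T" if "T \<in> S" for T
    using S[OF that] finite_subset by blast
  define X where "X = (SIGMA T:S. PiE T (\<lambda>_. {..<s}))"
  define h where "h = (\<lambda>(T, g). (\<lambda>t. t + m * g t) ` T :: nat set)"
  have md: "(t + m * g t) mod m = t" if "T \<in> S" "t \<in> T" for T t and g :: "nat \<Rightarrow> nat"
    using S[OF that(1)] that(2) by (auto simp: subset_iff)
  have im: "(\<lambda>x. x mod m) ` h (T, g) = T" if "T \<in> S" for T g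
    using md[OF that] by (force simp: h_def image_image)
  have "inj_on h X"
  proof (rule inj_onI, clarify)
    fix T g T' g'
    assume X: "(T, g) \<in> X" "(T', g') \<in> X" and eq: "h (T, g) = h (T', g')"
    have T: "T \<in> S" and g: "g \<in> PiE T (\<lambda>_. {..<s})" and "T' \<in> S"
      and g': "g' \<in> PiE T' (\<lambda>_. {..<s})"
      using X by (auto simp: X_def)
    have TT: "T = T'" using im[OF T, of g] im[OF \<open>T' \<in> S\<close>, of g'] eq by simp
    have "g t = g' t" if t: "t \<in> T" for t
    proof -
      have "t + m * g t \<in> h (T', g')" using t eq by (auto simp: h_def)
      then obtain u where u: "u \<in> T" "t + m * g t = u + m * g' u" by (auto simp: h_def TT)
      \<comment> \<open>Reduction modulo \<open>m\<close> recovers the part, so both vertices lie over \<open>t\<close>.\<close>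
      have "t = u" using md[OF T t, of g] md[OF T u(1), of g'] u(2) by simp
      moreover have "m > 0" using S[OF T] t by auto
      ultimately show ?thesis using u(2) by simp
    qed
    then have "g = g'" using g g' TT by (auto intro: PiE_ext)
    then show "T = T' \<and> g = g'" using TT by simp
  qed
  moreover have "h ` X \<subseteq> edges (blow_up m s S)"
  proof clarify
    fix T g assume "(T, g) \<in> X"
    then have T: "T \<in> S" and g: "g \<in> PiE T (\<lambda>_. {..<s})" by (auto simp: X_def)
    have "t + m * g t < m * s" if t: "t \<in> T" for t
    proof -
      have "t < m" "g t < s" using S[OF T] t g by auto
      then have "t + m * g t < m * Suc (g t)" "m * Suc (g t) \<le> m * s"
        by (simp, intro mult_le_mono2, simp)
      then show ?thesis by linarith
    qed
    then have "h (T, g) \<subseteq> {..<m * s}" by (auto simp: h_def)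
    moreover have "inj_on (\<lambda>x. x mod m) (h (T, g))"
      using md[OF T] by (auto simp: h_def inj_on_def)
    ultimately show "h (T, g) \<in> edges (blow_up m s S)"
      using im[OF T] T by (simp add: blow_up_def)
  qed
  moreover have "finite (edges (blow_up m s S))"
    by (rule finite_subset[of _ "Pow {..<m * s}"]) (auto simp: blow_up_def)
  ultimately have "card X \<le> card (edges (blow_up m s S))"
    by (metis card_image card_mono)
  moreover have "card X = (\<Sum>T\<in>S. s ^ k)"
    unfolding X_def using finS finT S by (subst card_SigmaI) (auto simp: card_PiE finite_PiE)
  ultimately show ?thesis by simp
qed

text \<open>
  Since \<open>(m s) choose k \<le> (m s)^k / k!\<close>, the edge density of each single blow-up is already at
  least the bound, which is the limit of these densities.
\<close>

lemma blow_up_density: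
  assumes F: "edges F \<noteq> {}" and m: "0 < m"
    and S: "\<And>T. T \<in> S \<Longrightarrow> T \<subseteq> {..<m} \<and> card T = k"
    and free: "\<And>s. \<not> contains_copy (blow_up m s S) F"
  shows "real (card S) * fact k / real m ^ k \<le> turan_density k F"
proof (rule turan_density_ge[OF F])
  fix n
  define s where "s = n + k + 1"
  define N where "N = m * s"
  have N: "s \<le> N" using m by (simp add: N_def)
  have pos: "0 < N choose k" using N by (intro zero_less_binomial) (simp add: s_def)
  have "card S * s ^ k \<le> turan_number k N F"
  proof (rule order_trans[OF card_edges_blow_up[OF S] turan_number_ge])
    show "kgraph k (blow_up m s S)" using S by (intro kgraph_blow_up) auto
    show "card (verts (blow_up m s S)) = N" by (simp add: blow_up_def N_def)
  qed (assumption, rule free)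
  moreover have "(N choose k) * fact k \<le> m ^ k * s ^ k"
    using binomial_fact_pow[of N k] by (simp add: N_def power_mult_distrib)
  ultimately have "(card S * s ^ k) * ((N choose k) * fact k)
      \<le> turan_number k N F * (m ^ k * s ^ k)"
    by (rule mult_le_mono)
  then have "s ^ k * (card S * fact k * (N choose k)) \<le> s ^ k * (turan_number k N F * m ^ k)"
    by (simp add: algebra_simps)
  then have "card S * fact k * (N choose k) \<le> turan_number k N F * m ^ k"
    by (simp add: s_def)
  then have "real (card S) * fact k * real (N choose k) \<le> real (turan_number k N F) * real m ^ k"
    by (metis (mono_tags, lifting) of_nat_fact of_nat_le_iff of_nat_mult of_nat_power)
  then have "real (card S) * fact k / real m ^ k \<le> real (turan_number k N F) / real (N choose k)"
    using pos m by (simp add: divide_simps)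
  moreover have "n \<le> N" using N by (simp add: s_def)
  ultimately show "\<exists>N\<ge>n. real (card S) * fact k / real m ^ k
      \<le> real (turan_number k N F) / real (N choose k)" by blast
qed

section \<open>Tents do not embed in blow-ups of packings\<close>

text \<open>
  The parts of \<open>lam\<close> add up to the size of the base, so the disjoint sets \<open>es i \<inter> e\<close> leave no
  vertex of the base uncovered.
\<close>

lemma tent_base_covered:
  assumes e: "finite e" "card e = sum_list lam"
    and cd: "\<forall>i<length lam. v \<in> es i \<and> card (es i \<inter> e) = lam ! i"
    and dj: "\<forall>i<length lam. \<forall>j<length lam. i \<noteq> j \<longrightarrow> es i \<inter> es j = {v}"
    and v: "v \<notin> e"
  shows "e \<subseteq> (\<Union>i<length lam. es i)"
proof -
  have "card (\<Union>i<length lam. es i \<inter> e) = (\<Sum>i<length lam. card (es i \<inter> e))"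
  proof (rule card_UN_disjoint)
    show "\<forall>i\<in>{..<length lam}. \<forall>j\<in>{..<length lam}.
        i \<noteq> j \<longrightarrow> (es i \<inter> e) \<inter> (es j \<inter> e) = {}"
    proof (intro ballI impI)
      fix i j assume "i \<in> {..<length lam}" "j \<in> {..<length lam}" "i \<noteq> j"
      then have "es i \<inter> es j = {v}" using dj by simp
      then show "(es i \<inter> e) \<inter> (es j \<inter> e) = {}"
        using v by (metis Int_insert_left_if0 Int_empty_left inf.assoc inf.commute inf.left_idem)
    qed
  qed (use e(1) in auto)
  also have "\<dots> = card e"
    using cd e(2) by (simp add: sum_list_sum_nth atLeast0LessThan)
  finally have "(\<Union>i<length lam. es i \<inter> e) = e"
    using e(1) by (intro card_subset_eq) auto
  then show ?thesis by blast
qed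

lemma blow_up_tent_free:
  assumes F: "is_tent lam F" and lam: "lam \<noteq> []"
    and packing: "\<And>T T'. T \<in> S \<Longrightarrow> T' \<in> S \<Longrightarrow> lam ! 0 \<le> card (T \<inter> T') \<Longrightarrow> T = T'"
    and fin: "\<And>T. T \<in> S \<Longrightarrow> finite T"
  shows "\<not> contains_copy (blow_up m s S) F"
proof
  assume "contains_copy (blow_up m s S) F"
  then obtain f where f: "inj_on f (verts F)"
    and fe: "\<And>e. e \<in> edges F \<Longrightarrow> f ` e \<in> edges (blow_up m s S)"
    by (auto simp: contains_copy_def)
  from F obtain e v es where kF: "kgraph (sum_list lam) F"
    and E: "edges F = insert e (es ` {..<length lam})" and V: "verts F = \<Union> (edges F)"
    and v: "v \<notin> e"
    and cd: "\<forall>i<length lam. v \<in> es i \<and> card (es i \<inter> e) = lam ! i"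
    and dj: "\<forall>i<length lam. \<forall>j<length lam. i \<noteq> j \<longrightarrow> es i \<inter> es j = {v}"
    unfolding is_tent_def by (elim conjE exE) (rule that; assumption)
  define part where "part x = f x mod m" for x
  have edge: "inj_on part g \<and> part ` g \<in> S" if "g \<in> edges F" for g
  proof -
    have "inj_on f g" using V that by (intro inj_on_subset[OF f]) auto
    moreover have "inj_on (\<lambda>x. x mod m) (f ` g)" "(\<lambda>x. x mod m) ` f ` g \<in> S"
      using fe[OF that] by (auto simp: blow_up_def)
    ultimately show ?thesis
      unfolding part_def using comp_inj_on[of f g "\<lambda>x. x mod m"]
      by (simp add: image_image o_def)
  qed
  have eF: "e \<in> edges F" and esF: "\<And>i. i < length lam \<Longrightarrow> es i \<in> edges F"
    using E by auto
  have l0: "0 < length lam" using lam by simp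
  have "part ` e = part ` es 0"
  proof (rule packing)
    show S: "part ` e \<in> S" "part ` es 0 \<in> S" using edge eF esF l0 by auto
    have "lam ! 0 = card (es 0 \<inter> e)" using cd l0 by simp
    also have "\<dots> = card (part ` (es 0 \<inter> e))"
      using edge[OF eF] by (metis card_image inf_le2 inj_on_subset)
    also have "\<dots> \<le> card (part ` e \<inter> part ` es 0)"
      using fin[OF S(1)] by (intro card_mono) auto
    finally show "lam ! 0 \<le> card (part ` e \<inter> part ` es 0)" .
  qed
  moreover have "v \<in> es 0" using cd l0 by simp
  ultimately have "part v \<in> part ` e" by blast
  then obtain u where u: "u \<in> e" "part u = part v" by auto
  have "finite e" "card e = sum_list lam"
    using kF eF by (auto simp: kgraph_def intro: finite_subset)
  then obtain i where i: "i < length lam" "u \<in> es i"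
    using tent_base_covered[OF _ _ cd dj v] u(1) by blast
  then have "u = v" using edge[OF esF[OF i(1)]] cd u(2) by (auto simp: inj_on_def)
  then show False using u(1) v by simp
qed

section \<open>Large packings\<close>

text \<open>
  The weight \<open>q^(r - card D)\<close> is at least \<open>1\<close> on the sets that are counted, and its sum over
  all subsets factorises.
\<close>

lemma card_small_subsets_le:
  fixes q r :: real
  assumes A: "finite A" and q: "1 \<le> q"
  shows "real (card {D. D \<subseteq> A \<and> real (card D) \<le> r}) \<le> q powr r * (1 + 1 / q) ^ card A"
proof -
  let ?X = "{D. D \<subseteq> A \<and> real (card D) \<le> r}"
  have w: "q powr (r - real (card D)) = q powr r * (1 / q) ^ card D" for D :: "'a set"
    using q by (simp add: powr_diff powr_realpow power_divide)
  have "real (card ?X) = (\<Sum>D\<in>?X. 1)" by simp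
  also have "\<dots> \<le> (\<Sum>D\<in>?X. q powr r * (1 / q) ^ card D)"
    unfolding w[symmetric] using q by (intro sum_mono) (auto intro: ge_one_powr_ge_zero)
  also have "\<dots> \<le> (\<Sum>D\<in>Pow A. q powr r * (1 / q) ^ card D)"
    using A q by (intro sum_mono2) auto
  also have "\<dots> = q powr r * (1 + 1 / q) ^ card A"
    using prod_add[OF A, of "\<lambda>_. 1 / q" "\<lambda>_. 1"] by (simp add: sum_distrib_left add.commute)
  finally show ?thesis .
qed

text \<open>The balls around the members of a maximal packing cover \<open>X\<close>.\<close>

lemma greedy_packing:
  assumes X: "finite X"
    and refl: "\<And>x. x \<in> X \<Longrightarrow> R x x" and sym: "\<And>x y. R x y \<Longrightarrow> R y x"
    and ball: "\<And>x. x \<in> X \<Longrightarrow> real (card {y \<in> X. R x y}) \<le> b"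
  obtains Y where "Y \<subseteq> X" "\<And>x y. x \<in> Y \<Longrightarrow> y \<in> Y \<Longrightarrow> R x y \<Longrightarrow> x = y"
    "real (card X) \<le> real (card Y) * b"
proof -
  let ?P = "{Y. Y \<subseteq> X \<and> (\<forall>x\<in>Y. \<forall>y\<in>Y. R x y \<longrightarrow> x = y)}"
  have "finite ?P" using X by simp
  moreover have "{} \<in> ?P" by simp
  then have "?P \<noteq> {}" by (metis empty_iff)
  ultimately have "\<exists>Y\<in>?P. \<forall>Z\<in>?P. Y \<subseteq> Z \<longrightarrow> Y = Z" by (rule finite_has_maximal)
  then obtain Y where Y: "Y \<in> ?P" and max: "\<forall>Z\<in>?P. Y \<subseteq> Z \<longrightarrow> Y = Z" ..
  have "X \<subseteq> (\<Union>x\<in>Y. {y \<in> X. R x y})"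
  proof
    fix z assume z: "z \<in> X"
    show "z \<in> (\<Union>x\<in>Y. {y \<in> X. R x y})"
    proof (rule ccontr)
      assume far: "z \<notin> (\<Union>x\<in>Y. {y \<in> X. R x y})"
      then have "\<not> R x z" "\<not> R z x" if "x \<in> Y" for x using that z sym by auto
      then have "insert z Y \<in> ?P" using Y z by auto
      then have "Y = insert z Y" by (rule max[rule_format]) (rule subset_insertI)
      then have "z \<in> Y" by blast
      then show False using far refl z by blast
    qed
  qed
  then have "card X \<le> card (\<Union>x\<in>Y. {y \<in> X. R x y})"
    by (rule card_mono[rotated]) (rule finite_subset[OF _ X], blast)
  also have "\<dots> \<le> (\<Sum>x\<in>Y. card {y \<in> X. R x y})"
    using Y X finite_subset by (intro card_UN_le) blast
  finally have "card X \<le> (\<Sum>x\<in>Y. card {y \<in> X. R x y})" .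
  then have "real (card X) \<le> (\<Sum>x\<in>Y. real (card {y \<in> X. R x y}))"
    by (metis of_nat_le_iff of_nat_sum)
  also have "\<dots> \<le> (\<Sum>x\<in>Y. b)" using ball Y by (intro sum_mono) blast
  finally show ?thesis using that Y by auto
qed

text \<open>
  A set of size \<open>k\<close> that meets \<open>T\<close> in more than \<open>\<alpha> k\<close> points is determined by its symmetric
  difference with \<open>T\<close>, a set of at most \<open>2 (1 - \<alpha>) k\<close> points.
\<close>

lemma card_close_sets_le:
  fixes \<alpha> q :: real
  assumes A: "finite A" and q: "1 \<le> q" and T: "T \<subseteq> A" "card T = k"
  shows "real (card {T'. (T' \<subseteq> A \<and> card T' = k) \<and> \<alpha> * real k < real (card (T \<inter> T'))})
    \<le> q powr (2 * (1 - \<alpha>) * real k) * (1 + 1 / q) ^ card A"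
proof -
  let ?B = "{T'. (T' \<subseteq> A \<and> card T' = k) \<and> \<alpha> * real k < real (card (T \<inter> T'))}"
  let ?D = "{D. D \<subseteq> A \<and> real (card D) \<le> 2 * (1 - \<alpha>) * real k}"
  define d where "d T' = (T - T') \<union> (T' - T)" for T'
  have "inj_on d ?B" by (rule inj_onI) (auto simp: d_def)
  moreover have "d ` ?B \<subseteq> ?D"
  proof clarify
    fix T' assume T': "T' \<subseteq> A" "k = card T'" and close: "\<alpha> * card T' < real (card (T \<inter> T'))"
    have fin: "finite T" "finite T'" using A T T' finite_subset by auto
    have "card (d T') = card (T - T') + card (T' - T)"
      unfolding d_def using fin by (intro card_Un_disjoint) auto
    moreover have "card T = card (T \<inter> T') + card (T - T')"
      using fin by (metis card_Int_Diff)
    moreover have "card T' = card (T \<inter> T') + card (T' - T)"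
      using fin by (metis card_Int_Diff inf_commute)
    ultimately have "real (card (d T')) = 2 * real k - 2 * real (card (T \<inter> T'))"
      using T T' by linarith
    then show "d T' \<subseteq> A \<and> real (card (d T')) \<le> 2 * (1 - \<alpha>) * real (card T')"
      using close T T' by (auto simp: d_def algebra_simps)
  qed
  ultimately have "card ?B \<le> card ?D"
    using A by (intro card_inj_on_le[of d]) auto
  then show ?thesis using card_small_subsets_le[OF A q, of "2 * (1 - \<alpha>) * real k"] by linarith
qed

text \<open>
  With \<open>q = 4\<close> a ball has at most \<open>4^(k/8) * (5/4)^(2k) \<le> (15/8)^k\<close> members, because
  \<open>4^(1/8) \<le> 6/5\<close>. What matters is that \<open>15/8 < 2\<close>: of the at least
  \<open>4^k / (2k)\<close> available sets, a share of one in \<open>(15/8)^k\<close> is still more than \<open>2^k\<close> sets.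
\<close>

lemma large_packing:
  assumes k: "0 < k" and large: "2 * real k < (16 / 15) ^ k"
  obtains S where "\<And>T. T \<in> S \<Longrightarrow> T \<subseteq> {..<2 * k} \<and> card T = k"
    "\<And>T T'. T \<in> S \<Longrightarrow> T' \<in> S \<Longrightarrow> 15 / 16 * real k < real (card (T \<inter> T')) \<Longrightarrow> T = T'"
    "2 ^ k < card S"
proof -
  let ?X = "{T. T \<subseteq> {..<2 * k} \<and> card T = k}"
  let ?R = "\<lambda>T T'. 15 / 16 * real k < real (card (T \<inter> T'))"
  have "(4 powr (1 / 8) :: real) ^ 8 \<le> (6 / 5) ^ 8"
    by (simp add: powr_realpow[symmetric] powr_powr power_divide)
  then have "(4 powr (1 / 8) :: real) \<le> 6 / 5"
    by (rule power_le_imp_le_base[of _ 7, simplified]) simp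
  then have "(4 powr (1 / 8) :: real) ^ k \<le> (6 / 5) ^ k" by (rule power_mono) simp
  then have "4 powr (2 * (1 - 15 / 16) * real k) \<le> (6 / 5 :: real) ^ k"
    by (simp add: powr_realpow[symmetric] powr_powr)
  then have "4 powr (2 * (1 - 15 / 16) * real k) * (1 + 1 / 4 :: real) ^ card {..<2 * k}
      \<le> (6 / 5) ^ k * (25 / 16) ^ k"
    by (simp add: power_mult power2_eq_square)
  also have "\<dots> = (15 / 8 :: real) ^ k" by (simp add: power_mult_distrib[symmetric])
  finally have b: "4 powr (2 * (1 - 15 / 16) * real k) * (1 + 1 / 4 :: real) ^ card {..<2 * k}
      \<le> (15 / 8) ^ k" .
  have fin: "finite ?X" by simp
  have refl: "?R T T" if "T \<in> ?X" for T using that k by simp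
  have sym: "?R T' T" if "?R T T'" for T T' using that by (simp add: Int_commute)
  have ball: "real (card {T' \<in> ?X. ?R T T'}) \<le> (15 / 8) ^ k" if "T \<in> ?X" for T
    using card_close_sets_le[of "{..<2 * k}" 4 T k "15 / 16"] that b by simp
  obtain S where S: "S \<subseteq> ?X" "\<And>T T'. T \<in> S \<Longrightarrow> T' \<in> S \<Longrightarrow> ?R T T' \<Longrightarrow> T = T'"
    and card: "real (card ?X) \<le> real (card S) * (15 / 8) ^ k"
    using greedy_packing[where X = ?X and R = ?R and b = "(15 / 8) ^ k", OF fin refl sym ball]
    by blast
  have "2 ^ k * (15 / 8) ^ k * (2 * real k) < 2 ^ k * (15 / 8) ^ k * (16 / 15 :: real) ^ k"
    using large by simp
  also have "\<dots> = 4 ^ k" by (simp add: power_mult_distrib[symmetric])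
  finally have "2 ^ k * (15 / 8) ^ k < 4 ^ k / (2 * real k)"
    using k by (simp add: field_simps)
  also have "\<dots> \<le> real (card ?X)"
    using central_binomial_lower_bound[OF k] by (simp add: n_subsets)
  finally have "2 ^ k * (15 / 8) ^ k < real (card S) * (15 / 8) ^ k" using card by linarith
  then have "2 ^ k < real (card S)" by simp
  then have "2 ^ k < card S"
    by (metis of_nat_less_numeral_power_cancel_iff of_nat_numeral of_nat_less_iff of_nat_power)
  then show ?thesis using that[of S] S by blast
qed

section \<open>The Turan density of tents with a dominating part\<close>

theorem theorem1p8:
  shows "\<exists>\<alpha>::real. \<alpha> < 1 \<and>
    (\<forall>\<^sub>F k in sequentially. \<forall>lam (F :: nat hypergraph).
       is_partition k lam \<longrightarrow> length lam \<ge> 2 \<longrightarrow> is_tent lam F \<longrightarrow> real (lam ! 0) > \<alpha> * real k \<longrightarrow>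
       turan_density k F > fact k / real k ^ k)"
proof (intro exI[of _ "15 / 16"] conjI)
  have "(\<lambda>k. real k * (15 / 16) ^ k) \<longlonglongrightarrow> 0"
    by (rule powser_times_n_limit_0) simp
  then have "\<forall>\<^sub>F k in sequentially. real k * (15 / 16) ^ k < 1 / 2"
    by (rule order_tendstoD) simp
  then have "\<forall>\<^sub>F k in sequentially. 2 * real k < (16 / 15) ^ k"
    by eventually_elim (simp add: power_divide field_simps)
  then show "\<forall>\<^sub>F k in sequentially. \<forall>lam (F :: nat hypergraph).
       is_partition k lam \<longrightarrow> length lam \<ge> 2 \<longrightarrow> is_tent lam F \<longrightarrow>
       real (lam ! 0) > 15 / 16 * real k \<longrightarrow> turan_density k F > fact k / real k ^ k"
    using eventually_gt_at_top[of 0]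
  proof (eventually_elim, intro allI impI)
    fix k lam and F :: "nat hypergraph"
    assume large: "2 * real k < (16 / 15) ^ k" and k: "0 < k"
      and len: "length lam \<ge> 2" and F: "is_tent lam F"
      and lam0: "real (lam ! 0) > 15 / 16 * real k"
    obtain S where S: "\<And>T. T \<in> S \<Longrightarrow> T \<subseteq> {..<2 * k} \<and> card T = k"
      and packing: "\<And>T T'. T \<in> S \<Longrightarrow> T' \<in> S \<Longrightarrow>
        15 / 16 * real k < real (card (T \<inter> T')) \<Longrightarrow> T = T'"
      and card: "2 ^ k < card S"
      using large_packing[OF k large] by blast
    have free: "\<not> contains_copy (blow_up (2 * k) s S) F" for s
    proof (rule blow_up_tent_free[OF F])
      show "lam \<noteq> []" using len by auto
      show "finite T" if "T \<in> S" for T using S[OF that] finite_subset by blast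
      show "T = T'" if "T \<in> S" "T' \<in> S" "lam ! 0 \<le> card (T \<inter> T')" for T T'
        using packing that lam0 by (meson less_le_trans of_nat_mono)
    qed
    have "edges F \<noteq> {}" using F by (auto simp: is_tent_def)
    then have "real (card S) * fact k / real (2 * k) ^ k \<le> turan_density k F"
      using k S free by (intro blow_up_density) auto
    moreover have "fact k / real k ^ k < real (card S) * fact k / real (2 * k) ^ k"
    proof -
      have "2 ^ k < real (card S)" using card by (metis of_nat_less_iff of_nat_numeral of_nat_power)
      then show ?thesis using k by (simp add: power_mult_distrib field_simps)
    qed
    ultimately show "turan_density k F > fact k / real k ^ k" by linarith
  qed
qed simp

end
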